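(* Let $(M^n,g)$ be a smooth pseudo-Riemannian manifold with a continuously differentiable $(0,2)$-tensor field $F=F_{ij}$ satisfying $F(v,v)\ge 0$ for all null vectors $v \in TM$. Then for each compact subset $Z\subset M$ there is a constant $C_Z\in\mathbb{R}$ such that $$F(p,p)\ \ge\ C_Z\,|g(p,p)|\qquad\text{for all } p\in T_zM \text{ with } z\in Z.$$
   Context: The metric $g$ is a smooth nondegenerate symmetric $(0,2)$-tensor field of arbitrary signature. A vector $v\in T_zM$ is null if $g_z(v,v)=0$. *)

theory Defs
  imports "HOL-Analysis.Analysis"
begin

text \<open>Regularity on open subsets of finite-dimensional spaces. Quantifying over all
  directions \<open>v\<close> makes this the usual notion of \<open>k\<close> times continuously differentiable maps.\<close>

primrec Ck_on :: "nat \<Rightarrow> ('a::euclidean_space \<Rightarrow> 'b::euclidean_space) \<Rightarrow> 'a set \<Rightarrow> bool" where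
  "Ck_on 0 f S \<longleftrightarrow> continuous_on S f"
| "Ck_on (Suc k) f S \<longleftrightarrow>
     (\<forall>x\<in>S. f differentiable (at x)) \<and>
     (\<forall>v. Ck_on k (\<lambda>x. frechet_derivative f (at x) v) S)"

definition smooth_on :: "('a::euclidean_space \<Rightarrow> 'b::euclidean_space) \<Rightarrow> 'a set \<Rightarrow> bool" where
  "smooth_on f S \<longleftrightarrow> (\<forall>k. Ck_on k f S)"

definition second_countable_space :: "'a topology \<Rightarrow> bool" where
  "second_countable_space X \<longleftrightarrow>
     (\<exists>\<B>. countable \<B> \<and> (\<forall>V\<in>\<B>. openin X V) \<and>
          (\<forall>U x. openin X U \<and> x \<in> U \<longrightarrow> (\<exists>V\<in>\<B>. x \<in> V \<and> V \<subseteq> U)))"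

text \<open>The values of \<open>chart_map c\<close> outside \<open>chart_domain c\<close> carry no meaning.\<close>

datatype ('a, 'n::finite) chart =
  Chart (chart_domain: "'a set") (chart_map: "'a \<Rightarrow> real ^ 'n")

definition chart_inv :: "('a, 'n::finite) chart \<Rightarrow> real ^ 'n \<Rightarrow> 'a" where
  "chart_inv c = inv_into (chart_domain c) (chart_map c)"

definition is_chart :: "'a topology \<Rightarrow> ('a, 'n::finite) chart \<Rightarrow> bool" where
  "is_chart X c \<longleftrightarrow>
     openin X (chart_domain c) \<and>
     open (chart_map c ` chart_domain c) \<and>
     homeomorphic_map (subtopology X (chart_domain c))
       (top_of_set (chart_map c ` chart_domain c)) (chart_map c)"

definition transition ::
    "('a, 'n::finite) chart \<Rightarrow> ('a, 'n) chart \<Rightarrow> real ^ 'n \<Rightarrow> real ^ 'n" where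
  "transition c d = chart_map d \<circ> chart_inv c"

text \<open>The atlas is not required to be maximal. The notions below give the same result
  for any atlas and for the maximal atlas containing it.\<close>

definition smooth_manifold :: "'a topology \<Rightarrow> ('a, 'n::finite) chart set \<Rightarrow> bool" where
  "smooth_manifold X A \<longleftrightarrow>
     Hausdorff_space X \<and> second_countable_space X \<and>
     (\<forall>c\<in>A. is_chart X c) \<and>
     topspace X = (\<Union>c\<in>A. chart_domain c) \<and>
     (\<forall>c\<in>A. \<forall>d\<in>A.
        smooth_on (transition c d) (chart_map c ` (chart_domain c \<inter> chart_domain d)))"

definition charts_at :: "('a, 'n::finite) chart set \<Rightarrow> 'a \<Rightarrow> ('a, 'n) chart set" where
  "charts_at A z = {c \<in> A. z \<in> chart_domain c}"

text \<open>A tangent vector at \<open>z\<close> is given by its component vectors in all charts around \<open>z\<close>,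
  related to each other by the differentials of the transition maps. The value at any other
  chart is fixed to be \<open>0\<close>, so that equality of tangent vectors is equality of functions.\<close>

type_synonym ('a, 'n) tangent = "('a, 'n) chart \<Rightarrow> real ^ 'n"

definition tangent_space :: "('a, 'n::finite) chart set \<Rightarrow> 'a \<Rightarrow> ('a, 'n) tangent set" where
  "tangent_space A z =
     {v. (\<forall>c. c \<notin> charts_at A z \<longrightarrow> v c = 0) \<and>
         (\<forall>c\<in>charts_at A z. \<forall>d\<in>charts_at A z.
            v d = frechet_derivative (transition c d) (at (chart_map c z)) (v c))}"

text \<open>The coordinate vector \<open>\<partial>\<^sub>i\<close> of the chart \<open>c\<close> at \<open>z\<close>.\<close>

definition coord_vector ::
    "('a, 'n::finite) chart set \<Rightarrow> ('a, 'n) chart \<Rightarrow> 'n \<Rightarrow> 'a \<Rightarrow> ('a, 'n) tangent" where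
  "coord_vector A c i z =
     (\<lambda>d. if d \<in> charts_at A z
          then frechet_derivative (transition c d) (at (chart_map c z)) (axis i 1) else 0)"

text \<open>The values of a \<open>(0,2)\<close>-tensor field at \<open>z\<close> matter only on tangent vectors at \<open>z\<close>.\<close>

type_synonym ('a, 'n) tensor02 =
  "'a \<Rightarrow> ('a, 'n) tangent \<Rightarrow> ('a, 'n) tangent \<Rightarrow> real"

definition tensor_field ::
    "'a topology \<Rightarrow> ('a, 'n::finite) chart set \<Rightarrow> ('a, 'n) tensor02 \<Rightarrow> bool" where
  "tensor_field X A T \<longleftrightarrow>
     (\<forall>z\<in>topspace X. \<forall>u\<in>tangent_space A z. \<forall>v\<in>tangent_space A z. \<forall>w\<in>tangent_space A z. \<forall>a.
        T z (\<lambda>c. u c + v c) w = T z u w + T z v w \<and>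
        T z w (\<lambda>c. u c + v c) = T z w u + T z w v \<and>
        T z (\<lambda>c. a *\<^sub>R u c) w = a * T z u w \<and>
        T z w (\<lambda>c. a *\<^sub>R u c) = a * T z w u)"

text \<open>The component function \<open>T\<^sub>i\<^sub>j\<close> in the coordinates of the chart \<open>c\<close>.\<close>

definition component ::
    "('a, 'n::finite) chart set \<Rightarrow> ('a, 'n) tensor02 \<Rightarrow> ('a, 'n) chart \<Rightarrow> 'n \<Rightarrow> 'n
      \<Rightarrow> real ^ 'n \<Rightarrow> real" where
  "component A T c i j =
     (\<lambda>x. T (chart_inv c x) (coord_vector A c i (chart_inv c x)) (coord_vector A c j (chart_inv c x)))"

definition C1_tensor_field ::
    "'a topology \<Rightarrow> ('a, 'n::finite) chart set \<Rightarrow> ('a, 'n) tensor02 \<Rightarrow> bool" where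
  "C1_tensor_field X A T \<longleftrightarrow> tensor_field X A T \<and>
     (\<forall>c\<in>A. \<forall>i j. Ck_on 1 (component A T c i j) (chart_map c ` chart_domain c))"

definition smooth_tensor_field ::
    "'a topology \<Rightarrow> ('a, 'n::finite) chart set \<Rightarrow> ('a, 'n) tensor02 \<Rightarrow> bool" where
  "smooth_tensor_field X A T \<longleftrightarrow> tensor_field X A T \<and>
     (\<forall>c\<in>A. \<forall>i j. smooth_on (component A T c i j) (chart_map c ` chart_domain c))"

definition pseudo_riemannian_metric ::
    "'a topology \<Rightarrow> ('a, 'n::finite) chart set \<Rightarrow> ('a, 'n) tensor02 \<Rightarrow> bool" where
  "pseudo_riemannian_metric X A g \<longleftrightarrow> smooth_tensor_field X A g \<and>
     (\<forall>z\<in>topspace X. \<forall>u\<in>tangent_space A z. \<forall>v\<in>tangent_space A z. g z u v = g z v u) \<and>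
     (\<forall>z\<in>topspace X. \<forall>u\<in>tangent_space A z.
        (\<forall>v\<in>tangent_space A z. g z u v = 0) \<longrightarrow> u = (\<lambda>_. 0))"

definition null_vector :: "('a, 'n::finite) tensor02 \<Rightarrow> 'a \<Rightarrow> ('a, 'n) tangent \<Rightarrow> bool" where
  "null_vector g z v \<longleftrightarrow> g z v v = 0"

end

theory Submission
  imports Defs
begin

text \<open>
  If \<open>g(p,p)\<close> and \<open>g(n,n)\<close> have opposite signs, the line \<open>p + t n\<close> meets the null cone at two
  parameters \<open>t\<close> of opposite sign whose product is \<open>g(p,p) / g(n,n)\<close>. Combining \<open>F \<ge> 0\<close> at the
  two null vectors so that the linear term in \<open>t\<close> cancels gives
  \<open>F(p,p) \<ge> (F(n,n) / g(n,n)) g(p,p)\<close>. Near a point where \<open>g\<close> is indefinite, two vectors \<open>n\<close> that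
  are constant in a chart, one of each sign, therefore bound \<open>F\<close> on all non-null vectors. Where
  \<open>g\<close> is semidefinite it is definite by nondegeneracy, and \<open>\<bar>g\<bar>\<close> locally dominates the squared
  Euclidean norm in the chart. Finitely many such neighbourhoods cover a compact set.
\<close>

section \<open>A real inequality from the two roots of a quadratic\<close>

lemma opposite_roots_ineq:
  fixes \<alpha> \<beta> \<gamma> A B D :: real
  assumes sgn: "\<alpha> * \<gamma> < 0"
    and nonneg: "\<And>t. \<alpha> + \<beta> * t + \<gamma> * t\<^sup>2 = 0 \<Longrightarrow> A + B * t + D * t\<^sup>2 \<ge> 0"
  shows "A \<ge> D / \<gamma> * \<alpha>"
proof -
  have \<gamma>: "\<gamma> \<noteq> 0" using sgn by auto
  \<comment> \<open>The discriminant is positive because \<open>\<alpha> * \<gamma> < 0\<close>, so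
    both roots are real.\<close>
  define s where "s = sqrt (\<beta>\<^sup>2 - 4 * \<alpha> * \<gamma>)"
  have s2: "s\<^sup>2 = \<beta>\<^sup>2 - 4 * \<alpha> * \<gamma>"
    unfolding s_def using sgn zero_le_power2[of \<beta>] by (intro real_sqrt_pow2) linarith
  have s_gt: "s > \<bar>\<beta>\<bar>"
    unfolding s_def using sgn by (intro real_less_rsqrt) auto
  define t u where "t = (- \<beta> + s) / (2 * \<gamma>)" and "u = (- \<beta> - s) / (2 * \<gamma>)"
  have t: "2 * \<gamma> * t = - \<beta> + s" and u: "2 * \<gamma> * u = - \<beta> - s"
    using \<gamma> by (simp_all add: t_def u_def)
  have root: "\<alpha> + \<beta> * r + \<gamma> * r\<^sup>2 = 0" if "(2 * \<gamma> * r + \<beta>)\<^sup>2 = s\<^sup>2" for r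
  proof -
    have "4 * \<gamma> * (\<alpha> + \<beta> * r + \<gamma> * r\<^sup>2) = (2 * \<gamma> * r + \<beta>)\<^sup>2 - s\<^sup>2"
      unfolding s2 by (simp add: power2_eq_square algebra_simps)
    then show ?thesis using that \<gamma> by auto
  qed
  have rt: "A + B * t + D * t\<^sup>2 \<ge> 0" and ru: "A + B * u + D * u\<^sup>2 \<ge> 0"
    by (auto intro!: nonneg root simp: t u)
  \<comment> \<open>Vieta's formula. It forces the roots to have opposite signs, and it turns the
    product \<open>D * (t * u)\<close> left after eliminating \<open>B\<close> into the constant of
    the conclusion.\<close>
  have prod: "t * u = \<alpha> / \<gamma>"
  proof -
    have "4 * \<gamma>\<^sup>2 * (t * u) = \<beta>\<^sup>2 - s\<^sup>2"
      using arg_cong2[OF t u, of "(*)"] by (simp add: power2_eq_square algebra_simps)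
    then have "4 * \<gamma> * (t * u * \<gamma>) = 4 * \<gamma> * \<alpha>"
      unfolding s2 by (simp add: power2_eq_square mult_ac)
    then show ?thesis using \<gamma> by (simp add: nonzero_eq_divide_eq)
  qed
  then have neg: "t * u < 0"
    using sgn by (auto simp: divide_less_0_iff mult_less_0_iff)
  text \<open>The roots \<open>t\<close> and \<open>u\<close> have opposite signs, so a positive combination of the two
    inequalities eliminates the coefficient \<open>B\<close>.\<close>
  have key: "y * (A + B * x + D * x\<^sup>2) - x * (A + B * y + D * y\<^sup>2) = (y - x) * (A - D * (x * y))" for x y
    by (simp add: power2_eq_square algebra_simps)
  have concl: "A - D * (x * y) \<ge> 0"
    if "x < 0" "y > 0" "A + B * x + D * x\<^sup>2 \<ge> 0" "A + B * y + D * y\<^sup>2 \<ge> 0" for x y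
  proof -
    have "y * (A + B * x + D * x\<^sup>2) \<ge> 0" "x * (A + B * y + D * y\<^sup>2) \<le> 0"
      by (rule mult_nonneg_nonneg, use that in simp_all) (rule mult_nonpos_nonneg, use that in simp_all)
    then have "(y - x) * (A - D * (x * y)) \<ge> 0"
      unfolding key[symmetric] by linarith
    moreover have "y - x > 0" using that by simp
    ultimately show ?thesis by (metis zero_le_mult_iff not_less)
  qed
  have "A - D * (t * u) \<ge> 0"
  proof (cases "t < 0")
    case True
    with neg show ?thesis using concl[OF _ _ rt ru] by (simp add: mult_less_0_iff)
  next
    case False
    with neg have "u < 0" "t > 0" by (auto simp: mult_less_0_iff)
    with concl[OF _ _ ru rt] show ?thesis by (simp only: mult.commute[of u t])
  qed
  then show ?thesis by (simp add: prod)
qed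

section \<open>Quadratic forms of matrices: algebra, definiteness and bounds that persist near a
  limit\<close>

definition quad :: "real ^ 'n ^ 'n \<Rightarrow> real ^ 'n::finite \<Rightarrow> real" where
  "quad M p = p \<bullet> (M *v p)"

lemma quad_eq_sum: "quad M p = (\<Sum>i\<in>UNIV. \<Sum>j\<in>UNIV. M $ i $ j * (p $ i * p $ j))"
  by (simp add: quad_def inner_vec_def matrix_vector_mult_def sum_distrib_left mult.assoc
      mult.left_commute)

lemma quad_diff: "quad (M - N) p = quad M p - quad N p"
  by (simp add: quad_def matrix_vector_mult_diff_rdistrib inner_diff_right)

lemma quad_minus: "quad (- M) p = - quad M p"
  using quad_diff[of 0 M p] by (simp add: quad_def)

lemma quad_scale: "quad M (a *\<^sub>R p) = a\<^sup>2 * quad M p"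
  by (simp add: quad_def matrix_vector_mult_scaleR power2_eq_square)

text \<open>The two mixed terms stay separate because \<open>M\<close> may be non-symmetric: the
  tensor field \<open>F\<close> carries no symmetry assumption.\<close>

lemma quad_add_scale:
  "quad M (p + t *\<^sub>R n) = quad M p + (p \<bullet> (M *v n) + n \<bullet> (M *v p)) * t + quad M n * t\<^sup>2"
  by (simp add: quad_def matrix_vector_right_distrib matrix_vector_mult_scaleR inner_add_left
      inner_add_right ring_distribs power2_eq_square)

text \<open>The entrywise sum serves as a matrix norm here because its convergence follows directly
  from that of the entries.\<close>

lemma abs_quad_le: "\<bar>quad M p\<bar> \<le> (\<Sum>i\<in>UNIV. \<Sum>j\<in>UNIV. \<bar>M $ i $ j\<bar>) * (norm p)\<^sup>2"
proof -
  have "\<bar>M $ i $ j * (p $ i * p $ j)\<bar> \<le> \<bar>M $ i $ j\<bar> * (norm p)\<^sup>2" for i j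
    unfolding abs_mult power2_eq_square
    by (intro mult_left_mono mult_mono component_le_norm_cart) auto
  then have "(\<Sum>i\<in>UNIV. \<Sum>j\<in>UNIV. \<bar>M $ i $ j * (p $ i * p $ j)\<bar>)
      \<le> (\<Sum>i\<in>UNIV. \<Sum>j\<in>UNIV. \<bar>M $ i $ j\<bar> * (norm p)\<^sup>2)"
    by (intro sum_mono)
  moreover have "\<bar>quad M p\<bar> \<le> (\<Sum>i\<in>UNIV. \<bar>\<Sum>j\<in>UNIV. M $ i $ j * (p $ i * p $ j)\<bar>)"
    unfolding quad_eq_sum by (rule sum_abs)
  moreover have "\<dots> \<le> (\<Sum>i\<in>UNIV. \<Sum>j\<in>UNIV. \<bar>M $ i $ j * (p $ i * p $ j)\<bar>)"
    by (intro sum_mono sum_abs)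
  ultimately show ?thesis unfolding sum_distrib_right by linarith
qed

lemma tendsto_quad:
  assumes "(M \<longlongrightarrow> M0) L"
  shows "((\<lambda>x. quad (M x) p) \<longlongrightarrow> quad M0 p) L"
  unfolding quad_eq_sum by (intro tendsto_intros assms)

text \<open>Along the line \<open>p + t *\<^sub>R n\<close> both forms are quadratic polynomials in
  \<open>t\<close>, and the null vectors of \<open>G\<close> on it are the roots of the first. The
  factor \<open>quad F n / quad G n\<close> does not depend on \<open>p\<close>, so one
  \<open>n\<close> serves all \<open>p\<close> of the opposite sign.\<close>

lemma quad_indefinite_ineq:
  assumes "quad G p * quad G n < 0"
    and null: "\<And>v. quad G v = 0 \<Longrightarrow> quad F v \<ge> 0"
  shows "quad F p \<ge> quad F n / quad G n * quad G p"
  using assms(1) null[of "p + _ *\<^sub>R n"]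
  unfolding quad_add_scale by (rule opposite_roots_ineq)

text \<open>A vector on which a nonnegative form vanishes minimises the form, so the first variation
  there is zero in every direction. By symmetry this says \<open>G *v u = 0\<close>, which
  nondegeneracy excludes.\<close>

lemma quad_pos_def_of_nonneg:
  assumes sym: "transpose G = G"
    and nondeg: "\<And>u. G *v u = 0 \<Longrightarrow> u = 0"
    and nonneg: "\<And>p. quad G p \<ge> 0"
    and "u \<noteq> 0"
  shows "quad G u > 0"
proof (rule ccontr)
  assume "\<not> quad G u > 0"
  then have u0: "quad G u = 0" using nonneg[of u] by auto
  have "v \<bullet> (G *v u) = 0" for v
  proof -
    define b c where "b = v \<bullet> (G *v u)" and "c = quad G v"
    \<comment> \<open>Symmetry makes both mixed terms equal to \<open>b\<close>, which gives the
      coefficient \<open>2 * b\<close> below.\<close>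
    have flip: "u \<bullet> (G *v v) = b"
      unfolding b_def by (metis dot_lmul_matrix inner_commute sym transpose_matrix_vector)
    have c: "c \<ge> 0" unfolding c_def by (rule nonneg)
    have "0 \<le> 2 * b * t + c * t\<^sup>2" for t
      using nonneg[of "u + t *\<^sub>R v"] unfolding quad_add_scale
      by (simp add: u0 flip b_def[symmetric] c_def[symmetric])
    \<comment> \<open>The minimiser of \<open>2 * b * t + c * t\<^sup>2\<close> would be
      \<open>- b / c\<close>. Adding 1 to the denominator covers \<open>c = 0\<close> as well and
      still makes the value negative unless \<open>b = 0\<close>.\<close>
    define t where "t = - b / (c + 1)"
    have t: "t * (c + 1) = - b" using c by (simp add: t_def)
    have "0 \<le> (2 * b * t + c * t\<^sup>2) * (c + 1)\<^sup>2"
      using \<open>\<And>t. 0 \<le> 2 * b * t + c * t\<^sup>2\<close> by simp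
    also have "\<dots> = 2 * b * (t * (c + 1)) * (c + 1) + c * (t * (c + 1))\<^sup>2"
      by (simp only: power2_eq_square ring_distribs mult_ac)
    also have "\<dots> = - (b\<^sup>2 * (c + 2))"
      unfolding t by (simp add: power2_eq_square algebra_simps)
    finally have "b\<^sup>2 * (c + 2) \<le> 0" by simp
    then show ?thesis
      using c unfolding b_def[symmetric] by (auto simp: mult_le_0_iff)
  qed
  then have "G *v u = 0" using inner_eq_zero_iff by blast
  with nondeg \<open>u \<noteq> 0\<close> show False by blast
qed

text \<open>The form attains a positive minimum on the compact unit sphere, and homogeneity of
  degree two carries this bound to all vectors.\<close>

lemma quad_pos_def_lower_bound:
  fixes G :: "real ^ 'n ^ 'n::finite"
  assumes "\<And>u. u \<noteq> 0 \<Longrightarrow> quad G u > 0"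
  obtains e where "e > 0" "\<And>p. quad G p \<ge> e * (norm p)\<^sup>2"
proof -
  have cont: "continuous_on (sphere 0 1) (quad G)"
    unfolding quad_eq_sum by (intro continuous_intros)
  have ne: "sphere (0 :: real ^ 'n) 1 \<noteq> {}" by simp
  obtain m where m: "m \<in> sphere 0 1" "\<And>p. p \<in> sphere 0 1 \<Longrightarrow> quad G m \<le> quad G p"
    using continuous_attains_inf[OF compact_sphere ne cont] by blast
  have "quad G p \<ge> quad G m * (norm p)\<^sup>2" for p
  proof (cases "p = 0")
    case False
    have "quad G p = (norm p)\<^sup>2 * quad G (p /\<^sub>R norm p)"
      using False by (simp add: quad_scale power_inverse)
    moreover have "quad G m \<le> quad G (p /\<^sub>R norm p)"
      using False by (intro m) simp
    ultimately show ?thesis by (metis mult.commute mult_left_mono zero_le_power2)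
  qed (simp add: quad_def)
  moreover have "quad G m > 0" using m(1) by (intro assms) auto
  ultimately show ?thesis using that by blast
qed

text \<open>The limit form \<open>G0\<close> decides the method. If it is negative at some
  \<open>n\<close>, then \<open>quad (G x) n < 0\<close> persists near the limit and this fixed
  \<open>n\<close> can be compared with every \<open>p\<close> of positive value. Otherwise
  \<open>G0\<close> is positive definite, and \<open>G x\<close> stays uniformly so.\<close>

lemma eventually_quad_lower_bound_pos:
  fixes G F :: "'b \<Rightarrow> real ^ 'n ^ 'n::finite"
  assumes G: "(G \<longlongrightarrow> G0) L" and F: "(F \<longlongrightarrow> F0) L"
    and sym: "transpose G0 = G0"
    and nondeg: "\<And>u. G0 *v u = 0 \<Longrightarrow> u = 0"
    and null: "eventually (\<lambda>x. \<forall>v. quad (G x) v = 0 \<longrightarrow> quad (F x) v \<ge> 0) L"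
  shows "\<exists>C. eventually (\<lambda>x. \<forall>p. quad (G x) p > 0 \<longrightarrow> quad (F x) p \<ge> C * quad (G x) p) L"
proof (cases "\<exists>n. quad G0 n < 0")
  case True
  then obtain n where n: "quad G0 n < 0" by blast
  \<comment> \<open>Subtracting 1 from the limiting ratio leaves room, so that the ratio at
    \<open>x\<close> eventually exceeds \<open>C\<close>.\<close>
  define C where "C = quad F0 n / quad G0 n - 1"
  have "((\<lambda>x. quad (F x) n / quad (G x) n) \<longlongrightarrow> quad F0 n / quad G0 n) L"
    using n by (intro tendsto_divide tendsto_quad F G) auto
  then have "eventually (\<lambda>x. quad (F x) n / quad (G x) n > C) L"
    by (rule order_tendstoD) (simp add: C_def)
  moreover have "eventually (\<lambda>x. quad (G x) n < 0) L"
    using tendsto_quad[OF G] n by (rule order_tendstoD)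
  ultimately have "eventually (\<lambda>x. \<forall>p. quad (G x) p > 0 \<longrightarrow> quad (F x) p \<ge> C * quad (G x) p) L"
    using null
  proof eventually_elim
    case (elim x)
    show ?case
    proof (intro allI impI)
      fix p assume p: "quad (G x) p > 0"
      have "quad (F x) p \<ge> quad (F x) n / quad (G x) n * quad (G x) p"
        using p elim by (intro quad_indefinite_ineq) (auto simp: mult_pos_neg)
      moreover have "C * quad (G x) p \<le> quad (F x) n / quad (G x) n * quad (G x) p"
        using p elim by (intro mult_right_mono) auto
      ultimately show "quad (F x) p \<ge> C * quad (G x) p" by linarith
    qed
  qed
  then show ?thesis by blast
next
  case False
  then have "quad G0 u > 0" if "u \<noteq> 0" for u
    using quad_pos_def_of_nonneg[OF sym nondeg _ that] by (meson not_le)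
  then obtain e where e: "e > 0" "\<And>p. quad G0 p \<ge> e * (norm p)\<^sup>2"
    using quad_pos_def_lower_bound by blast
  define S :: "real ^ 'n ^ 'n \<Rightarrow> real" where "S M = (\<Sum>i\<in>UNIV. \<Sum>j\<in>UNIV. \<bar>M $ i $ j\<bar>)" for M
  have S_tendsto: "((\<lambda>x. S (M x)) \<longlongrightarrow> S M0) L" if "(M \<longlongrightarrow> M0) L" for M M0
    unfolding S_def by (intro tendsto_intros that)
  \<comment> \<open>The added 1 is slack: \<open>S (F x)\<close> tends to \<open>S F0\<close> and is
    therefore eventually below \<open>K\<close>.\<close>
  define K where "K = S F0 + 1"
  have K: "K > 0" unfolding K_def S_def by (simp add: add_nonneg_pos sum_nonneg)
  have "((\<lambda>x. S (G x - G0)) \<longlongrightarrow> S (G0 - G0)) L"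
    by (intro S_tendsto tendsto_intros G)
  then have "eventually (\<lambda>x. S (G x - G0) < e / 2) L"
    by (rule order_tendstoD) (use e in \<open>simp add: S_def\<close>)
  moreover have "eventually (\<lambda>x. S (F x) < K) L"
    using S_tendsto[OF F] by (rule order_tendstoD) (simp add: K_def)
  \<comment> \<open>A perturbation of size \<open>e / 2\<close> leaves half of the lower bound of
    \<open>G0\<close>, so \<open>quad (G x) p\<close> is at least \<open>e / 2\<close> times the
    squared norm of \<open>p\<close>. The bound \<open>K\<close> on \<open>F x\<close> then produces
    the factor \<open>2 * K / e\<close>.\<close>
  ultimately have "eventually (\<lambda>x. \<forall>p. quad (G x) p > 0 \<longrightarrow>
      quad (F x) p \<ge> - (2 * K / e) * quad (G x) p) L"
  proof eventually_elim
    case (elim x)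
    show ?case
    proof (intro allI impI)
      fix p
      have "\<bar>quad (G x - G0) p\<bar> \<le> e / 2 * (norm p)\<^sup>2"
        using elim(1) by (intro order.trans[OF abs_quad_le] mult_right_mono) (auto simp: S_def)
      then have "quad (G x) p \<ge> e / 2 * (norm p)\<^sup>2"
        using e(2)[of p] unfolding quad_diff by linarith
      then have "K * (norm p)\<^sup>2 \<le> 2 * K / e * quad (G x) p"
        using e(1) K by (simp add: field_simps)
      moreover have "\<bar>quad (F x) p\<bar> \<le> K * (norm p)\<^sup>2"
        using elim(2) by (intro order.trans[OF abs_quad_le] mult_right_mono) (auto simp: S_def)
      ultimately show "quad (F x) p \<ge> - (2 * K / e) * quad (G x) p" by linarith
    qed
  qed
  then show ?thesis by blast
qed

text \<open>The one-sided estimate is applied to \<open>G\<close> and to \<open>- G\<close>, which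
  have the same null vectors. On those the claim is the assumption on \<open>F\<close>. The smaller
  of the two constants works for both signs because it multiplies an absolute value.\<close>

lemma eventually_quad_lower_bound:
  fixes G F :: "'b \<Rightarrow> real ^ 'n ^ 'n::finite"
  assumes G: "(G \<longlongrightarrow> G0) L" and F: "(F \<longlongrightarrow> F0) L"
    and sym: "transpose G0 = G0"
    and nondeg: "\<And>u. G0 *v u = 0 \<Longrightarrow> u = 0"
    and null: "eventually (\<lambda>x. \<forall>v. quad (G x) v = 0 \<longrightarrow> quad (F x) v \<ge> 0) L"
  shows "\<exists>C. eventually (\<lambda>x. \<forall>p. quad (F x) p \<ge> C * \<bar>quad (G x) p\<bar>) L"
proof -
  obtain C where C: "eventually (\<lambda>x. \<forall>p. quad (G x) p > 0 \<longrightarrow> quad (F x) p \<ge> C * quad (G x) p) L"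
    using eventually_quad_lower_bound_pos[OF assms] by blast
  have "\<exists>C. eventually (\<lambda>x. \<forall>p. quad (- G x) p > 0 \<longrightarrow> quad (F x) p \<ge> C * quad (- G x) p) L"
  proof (rule eventually_quad_lower_bound_pos)
    show "((\<lambda>x. - G x) \<longlongrightarrow> - G0) L" by (intro tendsto_intros G)
    show "transpose (- G0) = - G0"
      using sym by (simp add: transpose_def vec_eq_iff)
    show "u = 0" if "- G0 *v u = 0" for u
      using that nondeg[of u] matrix_vector_mult_diff_rdistrib[of 0 G0 u] by simp
    show "eventually (\<lambda>x. \<forall>v. quad (- G x) v = 0 \<longrightarrow> quad (F x) v \<ge> 0) L"
      using null by (simp add: quad_minus)
  qed (rule F)
  then obtain D where D: "eventually (\<lambda>x. \<forall>p. quad (- G x) p > 0 \<longrightarrow> quad (F x) p \<ge> D * quad (- G x) p) L"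
    by blast
  have "eventually (\<lambda>x. \<forall>p. quad (F x) p \<ge> min C D * \<bar>quad (G x) p\<bar>) L"
    using C D null
  proof eventually_elim
    case (elim x)
    show ?case
    proof
      fix p
      have CD: "min C D * \<bar>quad (G x) p\<bar> \<le> C * \<bar>quad (G x) p\<bar>"
        "min C D * \<bar>quad (G x) p\<bar> \<le> D * \<bar>quad (G x) p\<bar>"
        by (auto intro!: mult_right_mono)
      consider "quad (G x) p = 0" | "quad (G x) p > 0" | "quad (- G x) p > 0"
        unfolding quad_minus by linarith
      then show "quad (F x) p \<ge> min C D * \<bar>quad (G x) p\<bar>"
      proof cases
        case 1
        then show ?thesis using elim(3) by simp
      next
        case 2
        then have "quad (F x) p \<ge> C * quad (G x) p" using elim(1) by blast
        with CD(1) show ?thesis unfolding abs_of_pos[OF 2] by linarith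
      next
        case 3
        then have "quad (F x) p \<ge> D * quad (- G x) p" using elim(2) by blast
        moreover have "\<bar>quad (G x) p\<bar> = quad (- G x) p" using 3 by (simp add: quad_minus)
        ultimately show ?thesis using CD(2) by (metis order.trans)
      qed
    qed
  qed
  then show ?thesis by blast
qed

section \<open>Charts, transition maps and tangent vectors in coordinates\<close>

lemma Ck_on_1_imp_continuous_on: "Ck_on 1 f S \<Longrightarrow> continuous_on S f"
  by (auto intro!: continuous_at_imp_continuous_on differentiable_imp_continuous_within)

lemma smooth_on_imp_continuous_on: "smooth_on f S \<Longrightarrow> continuous_on S f"
  unfolding smooth_on_def by (metis Ck_on.simps(1))

lemma smooth_on_imp_differentiable: "smooth_on f S \<Longrightarrow> x \<in> S \<Longrightarrow> f differentiable (at x)"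
  unfolding smooth_on_def by (metis Ck_on.simps(2))

lemma is_chart_inj_on: "is_chart X c \<Longrightarrow> inj_on (chart_map c) (chart_domain c)"
  unfolding is_chart_def
  by (metis homeomorphic_eq_everything_map inf.absorb_iff2 openin_subset topspace_subtopology)

lemma is_chart_chart_inv:
  "is_chart X c \<Longrightarrow> z \<in> chart_domain c \<Longrightarrow> chart_inv c (chart_map c z) = z"
  unfolding chart_inv_def by (intro inv_into_f_f is_chart_inj_on)

text \<open>Turns a neighbourhood found in coordinates into an open set of the manifold.\<close>

lemma is_chart_openin_vimage:
  assumes "is_chart X c" "open S"
  shows "openin X {z \<in> chart_domain c. chart_map c z \<in> S}"
proof -
  have op: "openin X (chart_domain c)" using assms(1) by (simp add: is_chart_def)
  have ts: "topspace (subtopology X (chart_domain c)) = chart_domain c"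
    using openin_subset[OF op] by auto
  have "continuous_map (subtopology X (chart_domain c)) euclidean (chart_map c)"
    using assms(1) unfolding is_chart_def
    by (metis homeomorphic_imp_continuous_map continuous_map_in_subtopology)
  then have "openin (subtopology X (chart_domain c)) {z \<in> chart_domain c. chart_map c z \<in> S}"
    using assms(2) openin_continuous_map_preimage[of "subtopology X (chart_domain c)" euclidean "chart_map c" S]
    unfolding ts by simp
  then show ?thesis using op openin_open_subtopology by blast
qed

text \<open>Makes the overlap of two charts open in coordinates, so that maps agreeing on it have
  equal derivatives there.\<close>

lemma is_chart_open_image:
  assumes "is_chart X c" "openin X V"
  shows "open (chart_map c ` (chart_domain c \<inter> V))"
proof -
  have "openin (subtopology X (chart_domain c)) (chart_domain c \<inter> V)"
    using assms(2) by (metis inf_commute openin_subtopology)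
  then have "openin (top_of_set (chart_map c ` chart_domain c)) (chart_map c ` (chart_domain c \<inter> V))"
    using assms(1) unfolding is_chart_def
    by (meson homeomorphic_imp_open_map open_map_def)
  then show ?thesis
    using assms(1) unfolding is_chart_def by (metis openin_open_eq)
qed

lemma smooth_manifold_chart: "smooth_manifold X A \<Longrightarrow> c \<in> A \<Longrightarrow> is_chart X c"
  by (simp add: smooth_manifold_def)

lemma transition_differentiable:
  assumes "smooth_manifold X A" "c \<in> charts_at A z" "d \<in> charts_at A z"
  shows "transition c d differentiable (at (chart_map c z))"
  using assms unfolding smooth_manifold_def charts_at_def
  by (auto intro!: smooth_on_imp_differentiable[where S = "chart_map c ` (chart_domain c \<inter> chart_domain d)"])

text \<open>The chain rule applied to the cocycle identity of transition maps, which holds on an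
  open set around the point.\<close>

lemma transition_derivative_compose:
  assumes M: "smooth_manifold X A"
    and c: "c \<in> charts_at A z" and d: "d \<in> charts_at A z" and e: "e \<in> charts_at A z"
  shows "frechet_derivative (transition c e) (at (chart_map c z)) a =
    frechet_derivative (transition d e) (at (chart_map d z))
      (frechet_derivative (transition c d) (at (chart_map c z)) a)"
proof -
  have ch: "is_chart X c" "is_chart X d"
    and z: "z \<in> chart_domain c" "z \<in> chart_domain d"
    using smooth_manifold_chart[OF M] c d unfolding charts_at_def by auto
  define S where "S = chart_map c ` (chart_domain c \<inter> chart_domain d)"
  have S: "open S"
    unfolding S_def using ch(2) by (intro is_chart_open_image[OF ch(1)]) (simp add: is_chart_def)
  have zS: "chart_map c z \<in> S" using z by (auto simp: S_def)
  have tz: "transition c d (chart_map c z) = chart_map d z"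
    by (simp add: transition_def is_chart_chart_inv[OF ch(1) z(1)])
  \<comment> \<open>Both sides evaluate \<open>chart_map e\<close> at the same point of the
    manifold, so they agree on all of \<open>S\<close>, even at points outside the domain of
    \<open>e\<close>.\<close>
  have eq: "(transition d e \<circ> transition c d) x = transition c e x" if "x \<in> S" for x
    using that by (auto simp: S_def transition_def is_chart_chart_inv[OF ch(1)] is_chart_chart_inv[OF ch(2)])
  have cd: "(transition c d has_derivative frechet_derivative (transition c d) (at (chart_map c z)))
      (at (chart_map c z))"
    using transition_differentiable[OF M c d] frechet_derivative_works by blast
  have de: "(transition d e has_derivative frechet_derivative (transition d e) (at (chart_map d z)))
      (at (transition c d (chart_map c z)))"
    unfolding tz using transition_differentiable[OF M d e] frechet_derivative_works by blast
  have "(transition c e has_derivative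
      frechet_derivative (transition d e) (at (chart_map d z)) \<circ>
      frechet_derivative (transition c d) (at (chart_map c z))) (at (chart_map c z))"
    using diff_chain_at[OF cd de] S zS eq by (rule has_derivative_transform_within_open)
  from frechet_derivative_at[OF this] show ?thesis by (metis comp_apply)
qed

lemma transition_self_derivative:
  assumes M: "smooth_manifold X A" and c: "c \<in> charts_at A z"
  shows "frechet_derivative (transition c c) (at (chart_map c z)) = id"
proof -
  have ch: "is_chart X c" and z: "z \<in> chart_domain c"
    using smooth_manifold_chart[OF M] c unfolding charts_at_def by auto
  have "open (chart_map c ` chart_domain c)" using ch by (simp add: is_chart_def)
  then have "(transition c c has_derivative id) (at (chart_map c z))"
    using z by (rule has_derivative_transform_within_open[OF has_derivative_id _ imageI])
      (auto simp: transition_def is_chart_chart_inv[OF ch])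
  from frechet_derivative_at[OF this] show ?thesis by simp
qed

text \<open>Inverse to reading off the components \<open>v c\<close> of a tangent vector in the
  chart \<open>c\<close>. The value 0 elsewhere matches the normalisation in
  \<open>tangent_space\<close>.\<close>

definition tangent_lift ::
    "('a, 'n::finite) chart set \<Rightarrow> ('a, 'n) chart \<Rightarrow> 'a \<Rightarrow> real ^ 'n \<Rightarrow> ('a, 'n) tangent" where
  "tangent_lift A c z a =
     (\<lambda>d. if d \<in> charts_at A z
          then frechet_derivative (transition c d) (at (chart_map c z)) a else 0)"

lemma coord_vector_eq_lift: "coord_vector A c i z = tangent_lift A c z (axis i 1)"
  by (simp add: coord_vector_def tangent_lift_def)

text \<open>The compatibility required between two charts is exactly the chain rule for transition
  maps starting from \<open>c\<close>.\<close>

lemma tangent_lift_in_tangent_space: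
  assumes "smooth_manifold X A" "c \<in> charts_at A z"
  shows "tangent_lift A c z a \<in> tangent_space A z"
proof -
  have "tangent_lift A c z a e =
      frechet_derivative (transition d e) (at (chart_map d z)) (tangent_lift A c z a d)"
    if "d \<in> charts_at A z" "e \<in> charts_at A z" for d e
    unfolding tangent_lift_def if_P[OF that(1)] if_P[OF that(2)]
    using assms that by (rule transition_derivative_compose)
  moreover have "tangent_lift A c z a d = 0" if "d \<notin> charts_at A z" for d
    using that by (simp add: tangent_lift_def)
  ultimately show ?thesis unfolding tangent_space_def by blast
qed

lemma tangent_lift_self:
  assumes "smooth_manifold X A" "c \<in> charts_at A z"
  shows "tangent_lift A c z a c = a"
  using transition_self_derivative[OF assms] assms(2) by (simp add: tangent_lift_def)

lemma tangent_eq_lift: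
  assumes "c \<in> charts_at A z" "p \<in> tangent_space A z"
  shows "p = tangent_lift A c z (p c)"
proof
  fix d
  show "p d = tangent_lift A c z (p c) d"
  proof (cases "d \<in> charts_at A z")
    case True
    show ?thesis
      using assms True unfolding tangent_space_def tangent_lift_def if_P[OF True] by blast
  next
    case False
    show ?thesis
      using assms False unfolding tangent_space_def tangent_lift_def if_not_P[OF False] by blast
  qed
qed

lemma tangent_lift_linear:
  assumes "smooth_manifold X A" "c \<in> charts_at A z"
  shows "tangent_lift A c z (a + b) = (\<lambda>d. tangent_lift A c z a d + tangent_lift A c z b d)"
    and "tangent_lift A c z (r *\<^sub>R a) = (\<lambda>d. r *\<^sub>R tangent_lift A c z a d)"
  using linear_frechet_derivative[OF transition_differentiable[OF assms]]
  by (auto simp: tangent_lift_def linear_add linear_scale)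

section \<open>Tensor fields as matrices of components\<close>

definition component_matrix ::
    "('a, 'n::finite) chart set \<Rightarrow> ('a, 'n) tensor02 \<Rightarrow> ('a, 'n) chart \<Rightarrow> real ^ 'n \<Rightarrow> real ^ 'n ^ 'n" where
  "component_matrix A T c x = (\<chi> i j. component A T c i j x)"

lemma component_matrix_tendsto:
  assumes "open S" "x \<in> S" "\<And>i j. continuous_on S (component A T c i j)"
  shows "(component_matrix A T c \<longlongrightarrow> component_matrix A T c x) (at x)"
proof -
  have "(component A T c i j \<longlongrightarrow> component A T c i j x) (at x)" for i j
    using continuous_on_eq_continuous_at[OF assms(1)] assms(2,3) isContD by blast
  then show ?thesis unfolding component_matrix_def by (intro tendsto_vec_lambda)
qed

lemma bilinear_eq_matrix_form:
  fixes B :: "real ^ 'n::finite \<Rightarrow> real ^ 'n \<Rightarrow> real"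
  assumes "bilinear B"
  shows "B a b = a \<bullet> ((\<chi> i j. B (axis i 1) (axis j 1)) *v b)"
proof -
  have ab: "a = (\<Sum>i\<in>UNIV. a $ i *\<^sub>R axis i 1)" "b = (\<Sum>j\<in>UNIV. b $ j *\<^sub>R axis j 1)"
    using basis_expansion[of a] basis_expansion[of b] by (simp_all add: scalar_mult_eq_scaleR)
  have "B a b = (\<Sum>i\<in>UNIV. \<Sum>j\<in>UNIV. B (a $ i *\<^sub>R axis i 1) (b $ j *\<^sub>R axis j 1))"
    by (subst ab(1), subst ab(2)) (simp add: bilinear_sum[OF assms] sum.cartesian_product)
  also have "\<dots> = (\<Sum>i\<in>UNIV. a $ i * (\<Sum>j\<in>UNIV. B (axis i 1) (axis j 1) * b $ j))"
    by (simp add: bilinear_lmul[OF assms] bilinear_rmul[OF assms] sum_distrib_left mult_ac)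
  finally show ?thesis by (simp add: inner_vec_def matrix_vector_mult_def)
qed

text \<open>Pulled back along the linear lift, \<open>T z\<close> is a bilinear form on coordinate
  space. It is determined by its values on the axis vectors, whose lifts are the coordinate vectors
  defining the components.\<close>

lemma tensor_lift_eq:
  assumes M: "smooth_manifold X A" and T: "tensor_field X A T"
    and c: "c \<in> charts_at A z"
  shows "T z (tangent_lift A c z a) (tangent_lift A c z b) =
    a \<bullet> (component_matrix A T c (chart_map c z) *v b)"
proof -
  have ch: "is_chart X c" and z: "z \<in> chart_domain c"
    using smooth_manifold_chart[OF M] c unfolding charts_at_def by auto
  have zX: "z \<in> topspace X"
    using ch z openin_subset unfolding is_chart_def by blast
  note L = tangent_lift_in_tangent_space[OF M c]
  have "bilinear (\<lambda>a b. T z (tangent_lift A c z a) (tangent_lift A c z b))"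
    unfolding bilinear_def
    by (intro conjI allI linearI; simp only: tangent_lift_linear[OF M c] real_scaleR_def)
      (use T zX L in \<open>unfold tensor_field_def, blast\<close>)+
  from bilinear_eq_matrix_form[OF this, of a b] show ?thesis
    by (simp add: component_matrix_def component_def coord_vector_eq_lift is_chart_chart_inv[OF ch z])
qed

lemma tensor_eq_quad:
  assumes "smooth_manifold X A" "tensor_field X A T" "c \<in> charts_at A z" "p \<in> tangent_space A z"
  shows "T z p p = quad (component_matrix A T c (chart_map c z)) (p c)"
  using tensor_lift_eq[OF assms(1-3), of "p c" "p c"]
  unfolding tangent_eq_lift[OF assms(3,4), symmetric] quad_def .

lemma metric_component_matrix_symmetric:
  assumes M: "smooth_manifold X A" and g: "pseudo_riemannian_metric X A g"
    and c: "c \<in> charts_at A z" and z: "z \<in> topspace X"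
  shows "transpose (component_matrix A g c (chart_map c z)) = component_matrix A g c (chart_map c z)"
proof -
  have ch: "is_chart X c" and zc: "z \<in> chart_domain c"
    using smooth_manifold_chart[OF M] c unfolding charts_at_def by auto
  have "g z (tangent_lift A c z a) (tangent_lift A c z b) =
      g z (tangent_lift A c z b) (tangent_lift A c z a)" for a b
    using g z tangent_lift_in_tangent_space[OF M c] unfolding pseudo_riemannian_metric_def by blast
  then have "component A g c i j (chart_map c z) = component A g c j i (chart_map c z)" for i j
    unfolding component_def coord_vector_eq_lift is_chart_chart_inv[OF ch zc] by blast
  then show ?thesis by (simp only: transpose_def component_matrix_def vec_lambda_beta)
qed

text \<open>A kernel vector lifts to a tangent vector orthogonal to the whole tangent space. The
  matrix acts on the second argument and nondegeneracy is stated for the first, so symmetry of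
  \<open>g\<close> links the two.\<close>

lemma metric_component_matrix_nondegenerate:
  assumes M: "smooth_manifold X A" and g: "pseudo_riemannian_metric X A g"
    and c: "c \<in> charts_at A z" and z: "z \<in> topspace X"
    and u: "component_matrix A g c (chart_map c z) *v u = 0"
  shows "u = 0"
proof -
  have T: "tensor_field X A g" and sym: "\<And>v w. v \<in> tangent_space A z \<Longrightarrow> w \<in> tangent_space A z \<Longrightarrow> g z v w = g z w v"
    using g z unfolding pseudo_riemannian_metric_def smooth_tensor_field_def by blast+
  note L = tangent_lift_in_tangent_space[OF M c]
  have "g z (tangent_lift A c z u) v = 0" if v: "v \<in> tangent_space A z" for v
  proof -
    have "g z (tangent_lift A c z u) v = g z v (tangent_lift A c z u)"
      by (intro sym L v)
    also have "\<dots> = v c \<bullet> (component_matrix A g c (chart_map c z) *v u)"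
      using tensor_lift_eq[OF M T c, of "v c" u] unfolding tangent_eq_lift[OF c v, symmetric] .
    finally show ?thesis by (simp add: u)
  qed
  then have "tangent_lift A c z u = (\<lambda>_. 0)"
    using g z L unfolding pseudo_riemannian_metric_def by blast
  then show ?thesis using tangent_lift_self[OF M c, of u] by simp
qed

section \<open>From the estimate in one chart to compact sets\<close>

lemma local_lower_bound:
  assumes M: "smooth_manifold X A"
    and g: "pseudo_riemannian_metric X A g"
    and F: "C1_tensor_field X A F"
    and null: "\<And>z v. z \<in> topspace X \<Longrightarrow> v \<in> tangent_space A z \<Longrightarrow> null_vector g z v \<Longrightarrow> F z v v \<ge> 0"
    and w: "w \<in> topspace X"
  shows "\<exists>W C. openin X W \<and> w \<in> W \<and>
    (\<forall>z\<in>W. \<forall>p\<in>tangent_space A z. F z p p \<ge> C * \<bar>g z p p\<bar>)"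
proof -
  obtain c where cA: "c \<in> A" and wc: "w \<in> chart_domain c"
    using M w by (auto simp: smooth_manifold_def)
  have c: "c \<in> charts_at A z" if "z \<in> chart_domain c" for z
    using that cA by (simp add: charts_at_def)
  have ch: "is_chart X c" using M cA by (rule smooth_manifold_chart)
  have X: "z \<in> topspace X" if "z \<in> chart_domain c" for z
    using that ch openin_subset unfolding is_chart_def by blast
  define S where "S = chart_map c ` chart_domain c"
  have S: "open S" using ch by (simp add: S_def is_chart_def)
  have gT: "tensor_field X A g" and FT: "tensor_field X A F"
    using g F by (simp_all add: pseudo_riemannian_metric_def smooth_tensor_field_def C1_tensor_field_def)
  let ?x = "chart_map c w"
  let ?G = "component_matrix A g c" and ?F = "component_matrix A F c"
  have xS: "?x \<in> S" using wc by (simp add: S_def)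
  \<comment> \<open>The null cone varies with the point, so the hypothesis is transported to every
    point of the chart: a null coordinate vector lifts to a null tangent vector.\<close>
  have null': "quad (?F x) v \<ge> 0" if x: "x \<in> S" and v: "quad (?G x) v = 0" for x v
  proof -
    obtain z where z: "z \<in> chart_domain c" "x = chart_map c z" using x by (auto simp: S_def)
    let ?v = "tangent_lift A c z v"
    have L: "?v \<in> tangent_space A z" by (intro tangent_lift_in_tangent_space[OF M] c z)
    have "F z ?v ?v \<ge> 0"
      using tensor_lift_eq[OF M gT c[OF z(1)], of v v] v
      by (intro null X z L) (simp add: null_vector_def quad_def z(2))
    then show ?thesis
      using tensor_lift_eq[OF M FT c[OF z(1)], of v v] by (simp add: quad_def z(2))
  qed
  \<comment> \<open>The filter is \<open>nhds\<close> rather than \<open>at\<close> because the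
    bound must also hold at \<open>w\<close> itself.\<close>
  have "\<exists>C. eventually (\<lambda>x. \<forall>p. quad (?F x) p \<ge> C * \<bar>quad (?G x) p\<bar>) (nhds ?x)"
  proof (rule eventually_quad_lower_bound)
    have "\<And>i j. continuous_on S (component A g c i j)"
      using g cA by (auto simp: pseudo_riemannian_metric_def smooth_tensor_field_def S_def
          intro: smooth_on_imp_continuous_on)
    from component_matrix_tendsto[OF S xS this]
    show "(?G \<longlongrightarrow> ?G ?x) (nhds ?x)" by (rule tendsto_at_iff_tendsto_nhds[THEN iffD1])
    have "\<And>i j. continuous_on S (component A F c i j)"
      using F cA by (auto simp: C1_tensor_field_def S_def simp del: Ck_on.simps One_nat_def
          intro: Ck_on_1_imp_continuous_on)
    from component_matrix_tendsto[OF S xS this]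
    show "(?F \<longlongrightarrow> ?F ?x) (nhds ?x)" by (rule tendsto_at_iff_tendsto_nhds[THEN iffD1])
    show "transpose (?G ?x) = ?G ?x"
      by (intro metric_component_matrix_symmetric[OF M g] c wc w)
    show "u = 0" if "?G ?x *v u = 0" for u
      using metric_component_matrix_nondegenerate[OF M g c[OF wc] w that] .
    show "eventually (\<lambda>x. \<forall>v. quad (?G x) v = 0 \<longrightarrow> quad (?F x) v \<ge> 0) (nhds ?x)"
      unfolding eventually_nhds using S xS null' by blast
  qed
  then obtain C V where V: "open V" "?x \<in> V"
    "\<And>x p. x \<in> V \<Longrightarrow> quad (?F x) p \<ge> C * \<bar>quad (?G x) p\<bar>"
    unfolding eventually_nhds by blast
  define W where "W = {z \<in> chart_domain c. chart_map c z \<in> V}"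
  have "openin X W"
    unfolding W_def using ch V(1) by (rule is_chart_openin_vimage)
  moreover have "w \<in> W" using wc V(2) by (simp add: W_def)
  moreover have "F z p p \<ge> C * \<bar>g z p p\<bar>" if "z \<in> W" "p \<in> tangent_space A z" for z p
    using that V(3)[of "chart_map c z" "p c"]
    by (simp add: W_def tensor_eq_quad[OF M gT c] tensor_eq_quad[OF M FT c])
  ultimately show ?thesis by blast
qed

theorem theorem26:
  fixes X :: "'a topology"
    and A :: "('a, 'n::finite) chart set"
    and g F :: "('a, 'n) tensor02"
  assumes "smooth_manifold X A"
    and "pseudo_riemannian_metric X A g"
    and "C1_tensor_field X A F"
    and "\<And>z v. z \<in> topspace X \<Longrightarrow> v \<in> tangent_space A z \<Longrightarrow> null_vector g z v \<Longrightarrow> F z v v \<ge> 0"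
  shows "\<forall>Z. compactin X Z \<longrightarrow>
    (\<exists>C::real. \<forall>z\<in>Z. \<forall>p\<in>tangent_space A z. F z p p \<ge> C * \<bar>g z p p\<bar>)"
proof (intro allI impI)
  fix Z assume Z: "compactin X Z"
  define good where "good C W \<longleftrightarrow> (\<forall>z\<in>W. \<forall>p\<in>tangent_space A z. F z p p \<ge> C * \<bar>g z p p\<bar>)" for C W
  define \<U> where "\<U> = {W. openin X W \<and> (\<exists>C. good C W)}"
  have "Z \<subseteq> \<Union>\<U>"
  proof
    fix w assume "w \<in> Z"
    then have "w \<in> topspace X" using Z compactin_subset_topspace by blast
    with assms have "\<exists>W C. openin X W \<and> w \<in> W \<and> good C W"
      unfolding good_def by (rule local_lower_bound)
    then show "w \<in> \<Union>\<U>" unfolding \<U>_def by blast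
  qed
  moreover have "\<And>W. W \<in> \<U> \<Longrightarrow> openin X W" by (simp add: \<U>_def)
  ultimately obtain \<F> where fin: "finite \<F>" and sub: "\<F> \<subseteq> \<U>" and cov: "Z \<subseteq> \<Union>\<F>"
    using compactinD[OF Z] by metis
  have "\<forall>W\<in>\<F>. \<exists>C. good C W" using sub unfolding \<U>_def by blast
  then obtain C where C: "\<And>W. W \<in> \<F> \<Longrightarrow> good (C W) W"
    using bchoice[of \<F> "\<lambda>W C. good C W"] by blast
  \<comment> \<open>Inserting 0 keeps the minimum meaningful when the finite cover is empty.
    Lowering the constant is harmless because it multiplies an absolute value.\<close>
  define D where "D = Min (insert 0 (C ` \<F>))"
  have "F z p p \<ge> D * \<bar>g z p p\<bar>" if z: "z \<in> Z" and p: "p \<in> tangent_space A z" for z p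
  proof -
    obtain W where W: "W \<in> \<F>" "z \<in> W" using z cov by blast
    have "D \<le> C W" unfolding D_def using fin W(1) by (intro Min_le) auto
    then have "D * \<bar>g z p p\<bar> \<le> C W * \<bar>g z p p\<bar>" by (intro mult_right_mono) auto
    also have "\<dots> \<le> F z p p" using C[OF W(1)] W(2) p by (auto simp: good_def)
    finally show ?thesis .
  qed
  then show "\<exists>C. \<forall>z\<in>Z. \<forall>p\<in>tangent_space A z. F z p p \<ge> C * \<bar>g z p p\<bar>" by blast
qed

end
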